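(* Let $A\in\mathbf{R}^{m\times n}$ be column-normalized, i.e. $\|A_j\|_2=1$ for $j=1,\dots,n$, where $A_j$ is the $j$-th column of $A$. Let $\mu$ be the coherence of $A$, $\delta_k$ its restricted isometry constants, and $\beta_{k,p,q}$ its generalized restricted isometry constants. Then: (i) $\beta_{k,1,\infty}=\mu$ for $2\le k\le n$; (ii) $\beta_{k,2,2}=\delta_k$ for $1\le k\le n$.
   Context: $\|x\|_0$ is the number of nonzero components of $x$. Coherence: $\mu=\max_{i\ne j}\dfrac{|\langle A_i,A_j\rangle|}{\|A_i\|_2\|A_j\|_2}$. Restricted isometry constant: for $1\le k\le n$, $\delta_k$ is the smallest $\delta$ such that $(1-\delta)\|z\|_2^2\le\|Az\|_2^2\le(1+\delta)\|z\|_2^2$ for all $z\in\mathbf{R}^n$ with $\|z\|_0\le k$. Generalized restricted isometry constant: for $p\in[1,\infty)$, $q\in[1,\infty]$ with $\frac1p+\frac1q=1$ (with $1/\infty=0$), $$\beta_{k,p,q}=\sup_{S\subset\{1,\dots,n\},\,|S|\le k}\ \sup_{x\in\mathbf{R}^{|S|}\setminus\{0\}}\frac{\|(\mathbf{I}_{|S|}-A_S^TA_S)x\|_q}{\|x\|_p},$$ where $A_S$ is the submatrix of $A$ formed by the columns indexed by $S$ and $\mathbf{I}_r$ is the $r\times r$ identity. *)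

theory Defs
  imports "HOL-Analysis.Analysis"
begin

definition l0_norm :: "real ^ 'n \<Rightarrow> nat" where
  "l0_norm x = card {i. x $ i \<noteq> 0}"

definition coherence :: "real ^ 'n ^ 'm \<Rightarrow> real" where
  "coherence A = Max {\<bar>column i A \<bullet> column j A\<bar> / (norm (column i A) * norm (column j A)) | i j. i \<noteq> j}"

definition ric :: "real ^ 'n ^ 'm \<Rightarrow> nat \<Rightarrow> real" where
  "ric A k = (LEAST \<delta>. \<forall>z. l0_norm z \<le> k \<longrightarrow>
     (1 - \<delta>) * (norm z)\<^sup>2 \<le> (norm (A *v z))\<^sup>2 \<and>
     (norm (A *v z))\<^sup>2 \<le> (1 + \<delta>) * (norm z)\<^sup>2)"

text \<open>The space \<open>\<real>\<^bsup>|S|\<^esup>\<close> is represented as the functions on the index set \<open>S\<close>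
  itself (extensional, i.e. \<open>S \<rightarrow>\<^sub>E UNIV\<close>), so that no enumeration of \<open>S\<close> is needed.
  Inserting 0 below only matters for \<open>S = {}\<close>, where the norm is 0.\<close>

definition lp_norm :: "ereal \<Rightarrow> 'i set \<Rightarrow> ('i \<Rightarrow> real) \<Rightarrow> real" where
  "lp_norm p S x =
     (if p = \<infinity> then Max (insert 0 ((\<lambda>i. \<bar>x i\<bar>) ` S))
      else (\<Sum>i\<in>S. \<bar>x i\<bar> powr real_of_ereal p) powr (1 / real_of_ereal p))"

text \<open>The linear maps given by \<open>A\<^sub>S\<close> and its transpose, where \<open>A\<^sub>S\<close> is the submatrix
  of \<open>A\<close> formed by the columns indexed by \<open>S\<close>.\<close>

definition col_submatrix_mult :: "real ^ 'n ^ 'm \<Rightarrow> 'n set \<Rightarrow> ('n \<Rightarrow> real) \<Rightarrow> real ^ 'm" where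
  "col_submatrix_mult A S x = (\<Sum>j\<in>S. x j *\<^sub>R column j A)"

definition col_submatrix_transpose_mult :: "real ^ 'n ^ 'm \<Rightarrow> 'n set \<Rightarrow> real ^ 'm \<Rightarrow> 'n \<Rightarrow> real" where
  "col_submatrix_transpose_mult A S y = (\<lambda>j\<in>S. column j A \<bullet> y)"

text \<open>Intended for \<open>1 \<le> p < \<infinity>\<close>, \<open>1 \<le> q \<le> \<infinity>\<close> and \<open>1/p + 1/q = 1\<close>. The iterated supremum over
  \<open>S\<close> and \<open>x\<close> is taken over all pairs at once: \<open>S = {}\<close>, for which there is no nonzero \<open>x\<close>, then
  contributes nothing, whereas a separate inner supremum over the empty set of reals would be
  unspecified.\<close>

definition gric :: "real ^ 'n ^ 'm \<Rightarrow> nat \<Rightarrow> real \<Rightarrow> ereal \<Rightarrow> real" where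
  "gric A k p q = Sup
     {lp_norm q S (\<lambda>j\<in>S. x j - col_submatrix_transpose_mult A S (col_submatrix_mult A S x) j)
        / lp_norm (ereal p) S x
      | S x. card S \<le> k \<and> x \<in> S \<rightarrow>\<^sub>E UNIV \<and> (\<exists>j\<in>S. x j \<noteq> 0)}"

end

theory Submission
  imports Defs
begin

text \<open>Both identities concern the matrix \<open>I - A\<^sub>S\<^sup>T A\<^sub>S\<close>, whose diagonal vanishes and whose
  off-diagonal entries are the negated inner products of distinct columns of \<open>A\<close>.

  As an operator from the 1-norm to the maximum norm, a matrix has norm equal to the largest
  absolute value of its entries: no entry can contribute more than that, and a unit vector picks
  out a whole column. Since \<open>k \<ge> 2\<close>, the admissible sets include every pair of indices, so the
  largest entry that occurs is the coherence (lemma \<open>gric_1_infinity_eq_coherence\<close>).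

  As an operator on Euclidean space, the matrix is symmetric, and its quadratic form at \<open>z\<close> is
  \<open>\<parallel>z\<parallel>\<^sup>2 - \<parallel>A z\<parallel>\<^sup>2\<close>. For a symmetric matrix the operator norm equals the largest modulus of the
  quadratic form on unit vectors. Bounding that form by \<open>\<plusminus> \<delta> \<parallel>z\<parallel>\<^sup>2\<close> for all sparse \<open>z\<close> is precisely
  the restricted isometry inequality with constant \<open>\<delta>\<close>. Hence the valid restricted isometry
  constants are exactly the upper bounds of the quotients defining \<open>\<beta>\<close> (lemma
  \<open>restricted_isometry_iff_gram_defect\<close>), and the least of them is the supremum. One direction
  of this equivalence is the Cauchy-Schwarz inequality. The other is a polarization argument,
  lemma \<open>norm_gram_defect_le\<close>, which does without eigenvalues.\<close>

section \<open>Vectors supported on an index set\<close>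

text \<open>Restricted isometry constants range over vectors in the full space and \<open>gric\<close> over
  functions on \<open>S\<close>; extension by zero carries the second setting into the first.\<close>

definition zero_extend :: "'n set \<Rightarrow> ('n \<Rightarrow> real) \<Rightarrow> real ^ 'n" where
  "zero_extend S x = (\<chi> i. if i \<in> S then x i else 0)"

lemma zero_extend_nth [simp]: "zero_extend S x $ i = (if i \<in> S then x i else 0)"
  by (simp add: zero_extend_def)

lemma zero_extend_cong: "(\<And>i. i \<in> S \<Longrightarrow> x i = y i) \<Longrightarrow> zero_extend S x = zero_extend S y"
  by (simp add: vec_eq_iff)

lemma zero_extend_eq_0_iff: "zero_extend S x = 0 \<longleftrightarrow> (\<forall>i\<in>S. x i = 0)"
  by (auto simp: vec_eq_iff)

lemma l0_norm_le_card:
  fixes z :: "real ^ 'n"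
  assumes "\<And>i. i \<notin> S \<Longrightarrow> z $ i = 0"
  shows "l0_norm z \<le> card S"
  unfolding l0_norm_def using assms by (intro card_mono) auto

lemma inner_supported:
  fixes z y :: "real ^ 'n"
  assumes "\<And>i. i \<notin> S \<Longrightarrow> y $ i = 0"
  shows "z \<bullet> y = (\<Sum>i\<in>S. z $ i * y $ i)"
proof -
  have "(\<Sum>i\<in>S. z $ i * y $ i) = (\<Sum>i\<in>UNIV. z $ i * y $ i)"
    using assms by (intro sum.mono_neutral_left) auto
  then show ?thesis by (simp add: inner_vec_def)
qed

lemma lp_norm_2_eq_norm:
  fixes x :: "'n::finite \<Rightarrow> real"
  shows "lp_norm 2 S x = norm (zero_extend S x)"
proof -
  have "zero_extend S x \<bullet> zero_extend S x = (\<Sum>i\<in>S. (x i)\<^sup>2)"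
    by (subst inner_supported[of S]) (auto simp: power2_eq_square)
  then show ?thesis
    by (simp add: lp_norm_def norm_eq_sqrt_inner powr_half_sqrt sum_nonneg)
qed

lemma lp_norm_1: "lp_norm 1 S x = (\<Sum>i\<in>S. \<bar>x i\<bar>)"
  by (simp add: lp_norm_def sum_nonneg)

lemma col_submatrix_mult_eq:
  fixes A :: "real ^ 'n ^ 'm"
  shows "col_submatrix_mult A S x = A *v zero_extend S x"
proof -
  have "(\<Sum>j\<in>S. x j *\<^sub>R column j A) = (\<Sum>j\<in>UNIV. zero_extend S x $ j *\<^sub>R column j A)"
    by (intro sum.mono_neutral_cong_left) auto
  then show ?thesis
    by (simp add: col_submatrix_mult_def matrix_mult_sum scalar_mult_eq_scaleR)
qed

section \<open>Restricted isometry and the norm of the Gram defect\<close>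

text \<open>For \<open>z\<close> supported on \<open>S\<close> this is \<open>(I - A\<^sub>S\<^sup>T A\<^sub>S) z\<close>, kept in the full space.\<close>

definition gram_defect :: "real ^ 'n ^ 'm \<Rightarrow> 'n set \<Rightarrow> real ^ 'n \<Rightarrow> real ^ 'n" where
  "gram_defect A S z = zero_extend S (\<lambda>j. z $ j - column j A \<bullet> (A *v z))"

definition restricted_isometry :: "real ^ 'n ^ 'm \<Rightarrow> nat \<Rightarrow> real \<Rightarrow> bool" where
  "restricted_isometry A k \<delta> \<longleftrightarrow> (\<forall>z. l0_norm z \<le> k \<longrightarrow>
     (1 - \<delta>) * (norm z)\<^sup>2 \<le> (norm (A *v z))\<^sup>2 \<and>
     (norm (A *v z))\<^sup>2 \<le> (1 + \<delta>) * (norm z)\<^sup>2)"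

definition gram_defect_ratios :: "real ^ 'n ^ 'm \<Rightarrow> nat \<Rightarrow> real set" where
  "gram_defect_ratios A k = {norm (gram_defect A S z) / norm z | S z.
     card S \<le> k \<and> (\<forall>i. i \<notin> S \<longrightarrow> z $ i = 0) \<and> z \<noteq> 0}"

text \<open>Moving \<open>A\<^sub>S\<^sup>T\<close> to the other side of the inner product exhibits the defect as the operator
  of a symmetric bilinear form. Both halves of the comparison with the restricted isometry
  property work with this form.\<close>

lemma gram_defect_inner:
  fixes A :: "real ^ 'n ^ 'm"
  assumes y: "\<And>i. i \<notin> S \<Longrightarrow> y $ i = 0"
  shows "gram_defect A S z \<bullet> y = z \<bullet> y - (A *v z) \<bullet> (A *v y)"
proof -
  have "(A *v y) \<bullet> (A *v z) = (\<Sum>j\<in>UNIV. y $ j * (column j A \<bullet> (A *v z)))"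
    by (subst matrix_mult_sum) (simp add: scalar_mult_eq_scaleR inner_sum_left)
  also have "\<dots> = (\<Sum>j\<in>S. y $ j * (column j A \<bullet> (A *v z)))"
    using y by (intro sum.mono_neutral_right) auto
  finally have Ay: "(A *v z) \<bullet> (A *v y) = (\<Sum>j\<in>S. y $ j * (column j A \<bullet> (A *v z)))"
    by (simp add: inner_commute)
  have "gram_defect A S z \<bullet> y = (\<Sum>j\<in>S. (z $ j - column j A \<bullet> (A *v z)) * y $ j)"
    by (subst inner_supported[OF y]) (auto simp: gram_defect_def)
  also have "\<dots> = z \<bullet> y - (A *v z) \<bullet> (A *v y)"
    unfolding Ay using inner_supported[OF y, where z = z]
    by (simp add: algebra_simps sum_subtractf)
  finally show ?thesis .
qed

lemma restricted_isometry_iff_abs: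
  "restricted_isometry A k \<delta> \<longleftrightarrow>
     (\<forall>z. l0_norm z \<le> k \<longrightarrow> \<bar>(norm z)\<^sup>2 - (norm (A *v z))\<^sup>2\<bar> \<le> \<delta> * (norm z)\<^sup>2)"
proof -
  have "(1 - \<delta>) * a \<le> b \<and> b \<le> (1 + \<delta>) * a \<longleftrightarrow> \<bar>a - b\<bar> \<le> \<delta> * a" for a b :: real
    by (auto simp: algebra_simps abs_le_iff)
  then show ?thesis by (simp add: restricted_isometry_def)
qed

text \<open>A symmetric bilinear form \<open>B\<close> with \<open>\<bar>B v v\<bar> \<le> \<delta> \<parallel>v\<parallel>\<^sup>2\<close> also satisfies
  \<open>B z y \<le> \<delta> \<parallel>z\<parallel> \<parallel>y\<parallel>\<close>: for vectors of equal norm, expand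
  \<open>4 B z y = B (z + y) (z + y) - B (z - y) (z - y)\<close> and apply the parallelogram law. Taking \<open>y\<close>
  in the direction of the defect of \<open>z\<close> turns the left-hand side into the norm of the defect.
  The vectors \<open>z \<plusminus> y\<close> are again supported on \<open>S\<close>, so the sparse bound applies to them.\<close>

lemma norm_gram_defect_le:
  fixes A :: "real ^ 'n ^ 'm"
  assumes rip: "restricted_isometry A k \<delta>"
    and S: "card S \<le> k" and z: "\<And>i. i \<notin> S \<Longrightarrow> z $ i = 0" and "z \<noteq> 0"
  shows "norm (gram_defect A S z) \<le> \<delta> * norm z"
proof -
  define w where "w = gram_defect A S z"
  have w: "w $ i = 0" if "i \<notin> S" for i
    using that by (simp add: w_def gram_defect_def)
  have form: "\<bar>(norm v)\<^sup>2 - (norm (A *v v))\<^sup>2\<bar> \<le> \<delta> * (norm v)\<^sup>2"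
    if "\<And>i. i \<notin> S \<Longrightarrow> v $ i = 0" for v
    using rip order_trans[OF l0_norm_le_card[OF that] S]
    by (simp add: restricted_isometry_iff_abs)
  show ?thesis
  proof (cases "w = 0")
    case True
    \<comment> \<open>Here the claim reduces to \<open>0 \<le> \<delta>\<close>, which the nonzero vector \<open>z\<close> forces.\<close>
    have "0 \<le> \<delta> * (norm z)\<^sup>2"
      using form[OF z] by (meson abs_ge_zero order_trans)
    then have "0 \<le> \<delta>" using \<open>z \<noteq> 0\<close> by (simp add: zero_le_mult_iff)
    then show ?thesis using True by (simp add: w_def)
  next
    case False
    \<comment> \<open>With equal norms the parallelogram law gives exactly \<open>4 \<delta> \<parallel>z\<parallel>\<^sup>2\<close>.\<close>
    define t where "t = norm z / norm w"
    define y where "y = t *\<^sub>R w"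
    have y: "y $ i = 0" if "i \<notin> S" for i
      using w[OF that] by (simp add: y_def)
    have norm_y: "norm y = norm z"
      using False by (simp add: y_def t_def)
    have "gram_defect A S z \<bullet> y = t * (norm w)\<^sup>2"
      by (simp add: y_def w_def power2_norm_eq_inner)
    then have "norm z * norm w = gram_defect A S z \<bullet> y"
      using False by (simp add: t_def power2_eq_square)
    then have "4 * (norm z * norm w) = 4 * (z \<bullet> y - (A *v z) \<bullet> (A *v y))"
      using gram_defect_inner[OF y, where z = z and A = A] by simp
    also have "\<dots> = ((norm (z + y))\<^sup>2 - (norm (A *v (z + y)))\<^sup>2)
                   - ((norm (z - y))\<^sup>2 - (norm (A *v (z - y)))\<^sup>2)"
      by (simp add: power2_norm_eq_inner matrix_vector_right_distrib
          matrix_vector_mult_diff_distrib inner_add_left inner_add_right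
          inner_diff_left inner_diff_right inner_commute)
    also have "\<dots> \<le> \<delta> * (norm (z + y))\<^sup>2 + \<delta> * (norm (z - y))\<^sup>2"
      using form[of "z + y"] form[of "z - y"] z y by (simp add: abs_le_iff)
    also have "\<dots> = \<delta> * (2 * (norm z)\<^sup>2 + 2 * (norm y)\<^sup>2)"
      by (simp add: power2_norm_eq_inner inner_commute algebra_simps)
    also have "\<dots> = 4 * (norm z * (\<delta> * norm z))"
      by (simp add: norm_y power2_eq_square)
    finally show ?thesis
      using \<open>z \<noteq> 0\<close> by (simp add: w_def)
  qed
qed

lemma restricted_isometry_iff_gram_defect:
  fixes A :: "real ^ 'n ^ 'm"
  shows "restricted_isometry A k \<delta> \<longleftrightarrow> (\<forall>r\<in>gram_defect_ratios A k. r \<le> \<delta>)"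
proof
  assume "restricted_isometry A k \<delta>"
  then show "\<forall>r\<in>gram_defect_ratios A k. r \<le> \<delta>"
    by (auto simp: gram_defect_ratios_def divide_le_eq norm_gram_defect_le)
next
  assume bound: "\<forall>r\<in>gram_defect_ratios A k. r \<le> \<delta>"
  have "\<bar>(norm z)\<^sup>2 - (norm (A *v z))\<^sup>2\<bar> \<le> \<delta> * (norm z)\<^sup>2" if "l0_norm z \<le> k" for z
  proof (cases "z = 0")
    case False
    define S where "S = {i. z $ i \<noteq> 0}"
    have z: "z $ i = 0" if "i \<notin> S" for i using that by (simp add: S_def)
    have "card S \<le> k" using \<open>l0_norm z \<le> k\<close> by (simp add: S_def l0_norm_def)
    then have "norm (gram_defect A S z) / norm z \<le> \<delta>"
      using bound z False unfolding gram_defect_ratios_def by blast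
    then have le: "norm (gram_defect A S z) \<le> \<delta> * norm z"
      using False by (simp add: divide_le_eq)
    have "\<bar>(norm z)\<^sup>2 - (norm (A *v z))\<^sup>2\<bar> = \<bar>gram_defect A S z \<bullet> z\<bar>"
      using gram_defect_inner[OF z, where z = z and A = A] by (simp add: power2_norm_eq_inner)
    also have "\<dots> \<le> norm (gram_defect A S z) * norm z"
      by (rule Cauchy_Schwarz_ineq2)
    also have "\<dots> \<le> \<delta> * norm z * norm z"
      using le by (intro mult_right_mono) auto
    finally show ?thesis by (simp add: power2_eq_square mult.assoc)
  qed simp
  then show "restricted_isometry A k \<delta>" by (simp add: restricted_isometry_iff_abs)
qed

text \<open>Without some valid constant the set of quotients would be unbounded and its supremum
  meaningless; continuity of \<open>A\<close> supplies one.\<close>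

lemma restricted_isometry_exists:
  fixes A :: "real ^ 'n ^ 'm"
  shows "\<exists>\<delta>. restricted_isometry A k \<delta>"
proof -
  obtain K where K: "\<And>z. norm (A *v z) \<le> norm z * K"
    using bounded_linear.bounded[OF matrix_vector_mul_bounded_linear[of A]] by blast
  have "\<bar>(norm z)\<^sup>2 - (norm (A *v z))\<^sup>2\<bar> \<le> (1 + K\<^sup>2) * (norm z)\<^sup>2" for z
  proof -
    have "(norm (A *v z))\<^sup>2 \<le> (norm z * K)\<^sup>2"
      using K[of z] by (intro power_mono) auto
    then have "(norm (A *v z))\<^sup>2 \<le> K\<^sup>2 * (norm z)\<^sup>2"
      by (simp add: power_mult_distrib mult.commute)
    moreover have "0 \<le> K\<^sup>2 * (norm z)\<^sup>2" "0 \<le> (norm z)\<^sup>2" "0 \<le> (norm (A *v z))\<^sup>2"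
      by simp_all
    ultimately show ?thesis by (simp only: abs_le_iff distrib_right) linarith
  qed
  then show ?thesis unfolding restricted_isometry_iff_abs by blast
qed

text \<open>The hypothesis \<open>1 \<le> k\<close> makes the set of quotients nonempty, as it admits a
  singleton \<open>S\<close>.\<close>

lemma ric_eq_Sup:
  fixes A :: "real ^ 'n ^ 'm"
  assumes "1 \<le> k"
  shows "ric A k = Sup (gram_defect_ratios A k)"
proof -
  fix i :: 'n
  have "norm (gram_defect A {i} (axis i 1)) / norm (axis i 1 :: real ^ 'n) \<in> gram_defect_ratios A k"
    unfolding gram_defect_ratios_def using assms
    by (intro CollectI exI[of _ "{i}"] exI[of _ "axis i 1"]) (auto simp: axis_def vec_eq_iff)
  then have ne: "gram_defect_ratios A k \<noteq> {}" by blast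
  have bdd: "bdd_above (gram_defect_ratios A k)"
    using restricted_isometry_exists[of A k]
    unfolding restricted_isometry_iff_gram_defect bdd_above_def by blast
  have "ric A k = (LEAST \<delta>. restricted_isometry A k \<delta>)"
    by (simp add: ric_def restricted_isometry_def)
  also have "\<dots> = Sup (gram_defect_ratios A k)"
    unfolding restricted_isometry_iff_gram_defect
    using ne bdd by (intro Least_equality) (auto intro: cSup_upper cSup_least)
  finally show ?thesis .
qed

lemma gric_2_2_eq_Sup:
  fixes A :: "real ^ 'n ^ 'm"
  shows "gric A k 2 2 = Sup (gram_defect_ratios A k)"
proof -
  have ratio: "lp_norm 2 S (\<lambda>j\<in>S. x j - col_submatrix_transpose_mult A S (col_submatrix_mult A S x) j)
        / lp_norm (ereal 2) S x
      = norm (gram_defect A S (zero_extend S x)) / norm (zero_extend S x)" for S x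
    unfolding gram_defect_def numeral_eq_ereal[symmetric] lp_norm_2_eq_norm
    by (intro arg_cong2[where f = "(/)"] arg_cong[where f = norm] zero_extend_cong)
      (auto simp: col_submatrix_transpose_mult_def col_submatrix_mult_eq)
  have "(\<exists>S x. r = norm (gram_defect A S (zero_extend S x)) / norm (zero_extend S x) \<and>
            card S \<le> k \<and> x \<in> S \<rightarrow>\<^sub>E UNIV \<and> (\<exists>j\<in>S. x j \<noteq> 0))
      \<longleftrightarrow> r \<in> gram_defect_ratios A k" (is "?L \<longleftrightarrow> ?R") for r
  proof
    assume ?L
    then obtain S x where *: "r = norm (gram_defect A S (zero_extend S x)) / norm (zero_extend S x)"
      "card S \<le> k" "\<exists>j\<in>S. x j \<noteq> 0" by blast
    then show ?R unfolding gram_defect_ratios_def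
      by (intro CollectI exI[of _ S] exI[of _ "zero_extend S x"]) (auto simp: zero_extend_eq_0_iff)
  next
    assume ?R
    then obtain S z where *: "r = norm (gram_defect A S z) / norm z" "card S \<le> k"
      "\<forall>i. i \<notin> S \<longrightarrow> z $ i = 0" "z \<noteq> 0" unfolding gram_defect_ratios_def by blast
    define x where "x = restrict (($) z) S"
    have z: "zero_extend S x = z" using * by (auto simp: vec_eq_iff x_def)
    then have "\<exists>j\<in>S. x j \<noteq> 0" using \<open>z \<noteq> 0\<close> zero_extend_eq_0_iff by metis
    then show ?L using * z
      by (intro exI[of _ S] exI[of _ x]) (auto simp: x_def)
  qed
  then show ?thesis unfolding gric_def ratio
    by (intro arg_cong[where f = Sup]) auto
qed

section \<open>Coherence\<close>

lemma coherence_normalized: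
  fixes A :: "real ^ 'n ^ 'm"
  assumes "\<And>j. norm (column j A) = 1"
  shows "coherence A = Max {\<bar>column i A \<bullet> column j A\<bar> | i j. i \<noteq> j}"
  by (simp add: coherence_def assms)

lemma finite_column_inners:
  fixes A :: "real ^ 'n ^ 'm"
  shows "finite {\<bar>column i A \<bullet> column j A\<bar> | i j. i \<noteq> j}"
  by (rule finite_subset[of _ "(\<lambda>(i, j). \<bar>column i A \<bullet> column j A\<bar>) ` UNIV"]) auto

lemma column_inner_le_coherence:
  fixes A :: "real ^ 'n ^ 'm"
  assumes "\<And>j. norm (column j A) = 1" and "i \<noteq> j"
  shows "\<bar>column i A \<bullet> column j A\<bar> \<le> coherence A"
  unfolding coherence_normalized[OF assms(1)]
  using assms(2) by (intro Max_ge finite_column_inners) auto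

lemma coherence_attained:
  fixes A :: "real ^ 'n ^ 'm"
  assumes "\<And>j. norm (column j A) = 1" and "2 \<le> CARD('n)"
  obtains i j where "i \<noteq> j" "coherence A = \<bar>column i A \<bullet> column j A\<bar>"
proof -
  have "\<not> card (UNIV :: 'n set) \<le> 1" using assms(2) by simp
  then have "\<exists>i j :: 'n. i \<noteq> j" by (subst (asm) card_le_Suc0_iff_eq[unfolded One_nat_def[symmetric]]) auto
  then have "{\<bar>column i A \<bullet> column j A\<bar> | i j. i \<noteq> j} \<noteq> {}" by blast
  from Max_in[OF finite_column_inners this] show ?thesis
    using that unfolding coherence_normalized[OF assms(1)] by blast
qed

text \<open>Normalization of column \<open>i\<close> cancels the diagonal term, leaving only inner products of
  distinct columns.\<close>

lemma gram_entry:
  fixes A :: "real ^ 'n ^ 'm"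
  assumes "norm (column i A) = 1" and "i \<in> S"
  shows "x i - col_submatrix_transpose_mult A S (col_submatrix_mult A S x) i
       = - (\<Sum>j\<in>S - {i}. (column i A \<bullet> column j A) * x j)"
proof -
  have "column i A \<bullet> column i A = 1"
    using assms(1) by (simp add: norm_eq_1)
  then have "(\<Sum>j\<in>S. (column i A \<bullet> column j A) * x j)
      = x i + (\<Sum>j\<in>S - {i}. (column i A \<bullet> column j A) * x j)"
    using assms(2) by (subst sum.remove[of S i]) auto
  then show ?thesis using assms(2)
    by (simp add: col_submatrix_transpose_mult_def col_submatrix_mult_def inner_sum_right mult.commute)
qed

text \<open>Each entry of the defect is a combination of the \<open>x j\<close> with coefficients bounded by the
  coherence, which gives the upper bound. The supremum is a maximum: a pair of columns attaining
  the coherence provides the witness.\<close>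

lemma gric_1_infinity_eq_coherence:
  fixes A :: "real ^ 'n ^ 'm"
  assumes normalized: "\<And>j. norm (column j A) = 1" and k: "2 \<le> k" and n: "2 \<le> CARD('n)"
  shows "gric A k 1 \<infinity> = coherence A"
proof -
  obtain a b where ab: "a \<noteq> b" "coherence A = \<bar>column a A \<bullet> column b A\<bar>"
    using coherence_attained[OF normalized n] .
  let ?defect = "\<lambda>S x. \<lambda>j\<in>S. x j - col_submatrix_transpose_mult A S (col_submatrix_mult A S x) j"
  have upper: "lp_norm \<infinity> S (?defect S x) / lp_norm 1 S x \<le> coherence A"
    if nz: "\<exists>j\<in>S. x j \<noteq> 0" for S x
  proof -
    have pos: "0 < (\<Sum>i\<in>S. \<bar>x i\<bar>)"
    proof -
      from nz obtain j where "j \<in> S" "x j \<noteq> 0" by blast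
      then show ?thesis by (intro sum_pos2[of S j]) auto
    qed
    have entry: "\<bar>?defect S x i\<bar> \<le> coherence A * (\<Sum>j\<in>S. \<bar>x j\<bar>)" if "i \<in> S" for i
    proof -
      have "\<bar>?defect S x i\<bar> = \<bar>\<Sum>j\<in>S - {i}. (column i A \<bullet> column j A) * x j\<bar>"
        using that by (simp add: gram_entry normalized)
      also have "\<dots> \<le> (\<Sum>j\<in>S - {i}. \<bar>column i A \<bullet> column j A\<bar> * \<bar>x j\<bar>)"
        by (rule order_trans[OF sum_abs]) (simp add: abs_mult)
      also have "\<dots> \<le> (\<Sum>j\<in>S - {i}. coherence A * \<bar>x j\<bar>)"
        by (intro sum_mono mult_right_mono column_inner_le_coherence normalized) auto
      also have "\<dots> \<le> (\<Sum>j\<in>S. coherence A * \<bar>x j\<bar>)"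
        using ab(2) by (intro sum_mono2) auto
      finally show ?thesis by (simp add: sum_distrib_left)
    qed
    have "lp_norm \<infinity> S (?defect S x) \<le> coherence A * (\<Sum>j\<in>S. \<bar>x j\<bar>)"
      unfolding lp_norm_def using entry pos ab(2) by (auto intro!: mult_nonneg_nonneg)
    then show ?thesis using pos by (simp add: lp_norm_1 divide_le_eq)
  qed
  \<comment> \<open>On \<open>S = {a, b}\<close>, applying \<open>I - A\<^sub>S\<^sup>T A\<^sub>S\<close> to the unit vector at \<open>b\<close> leaves only
    the entry at \<open>a\<close>, which is the extremal inner product up to sign.\<close>
  define x where "x = (\<lambda>j\<in>{a, b}. if j = b then 1 else 0 :: real)"
  have "x a = 0" "x b = 1"
    using ab(1) by (simp_all add: x_def)
  moreover have "{a, b} - {a} = {b}" "{a, b} - {b} = {a}"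
    using ab(1) by auto
  ultimately have "?defect {a, b} x a = - (column a A \<bullet> column b A)" "?defect {a, b} x b = 0"
    using gram_entry[OF normalized, of a "{a, b}" x] gram_entry[OF normalized, of b "{a, b}" x]
    by simp_all
  then have "lp_norm \<infinity> {a, b} (?defect {a, b} x) = coherence A"
    using ab by (simp add: lp_norm_def)
  moreover have "lp_norm 1 {a, b} x = 1"
    using ab(1) by (simp add: lp_norm_1 x_def)
  ultimately have attained: "coherence A = lp_norm \<infinity> {a, b} (?defect {a, b} x) / lp_norm 1 {a, b} x"
    by simp
  show ?thesis
    unfolding gric_def one_ereal_def[symmetric]
  proof (rule cSup_eq_maximum, goal_cases)
    case 1
    have "card {a, b} \<le> k" using k ab(1) by simp
    moreover have "x \<in> {a, b} \<rightarrow>\<^sub>E UNIV" "\<exists>j\<in>{a, b}. x j \<noteq> 0"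
      by (auto simp: x_def)
    ultimately show ?case using attained by blast
  qed (use upper in auto)
qed

theorem proposition2:
  fixes A :: "real ^ 'n ^ 'm"
  assumes "\<And>j. norm (column j A) = 1"
  shows "(\<forall>k. 2 \<le> k \<and> k \<le> CARD('n) \<longrightarrow> gric A k 1 \<infinity> = coherence A) \<and>
         (\<forall>k. 1 \<le> k \<and> k \<le> CARD('n) \<longrightarrow> gric A k 2 2 = ric A k)"
  using gric_1_infinity_eq_coherence[OF assms] gric_2_2_eq_Sup[of A] ric_eq_Sup[of _ A]
  by (metis order_trans)

end
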